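(* Let $f_0,F:\mathbb{R}^n\times\mathbb{R}^d\to\mathbb{R}$ be twice continuously differentiable. For $w\in\mathbb{R}^d$ put $C(w)=\{x\in\mathbb{R}^n\mid F(x,w)\le 0\}$, and for $(x,w)\in\mathbb{R}^n\times\mathbb{R}^d$ put $G(x,w)=\nabla_xf_0(x,w)$ and $M(x,w)=N_{C(w)}(x)$ (the partial limiting subdifferential in $x$ of the indicator function of $\{F\le 0\}$). Let $$S(w)=\{x\in\mathbb{R}^n\mid 0\in G(x,w)+M(x,w)\}.$$ Let $\bar w\in\mathbb{R}^d$, $\bar x\in S(\bar w)$, $\bar\tau=(\bar x,\bar w,-\nabla_xf_0(\bar x,\bar w))\in\mathrm{gph}\,M$, and suppose that $F(\bar x,\bar w)<0$, so that $(\bar x,\bar w)$ is an interior point of $\{(x,w)\mid F(x,w)\le 0\}$. Then the following hold. (1) $D^*M(\bar\tau)(v'_1)=\widehat D^*M(\bar\tau)(v'_1)=\{0\}$ for any $v'_1\in\mathbb{R}^n$; consequently, $M$ is graphically regular at $\bar\tau$. (2) Suppose that the following constraint qualification is fulfilled: $$0\in\nabla G(\bar x,\bar w)^*v'_1+D^*M(\bar\tau)(v'_1)\ \Longrightarrow\ v'_1=0.\qquad(\mathrm{CQ})$$ Then, for any $x'\in\mathbb{R}^n$, $\widehat\Gamma(x')=D^*S(\bar w|\bar x)(x')=\Gamma(x')$, where $$\widehat\Gamma(x')=\bigcup_{v'_1\in\mathbb{R}^n}\{w'\in\mathbb{R}^d\mid(-x',w')\in\nabla G(\bar x,\bar w)^*v'_1+\widehat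 D^*M(\bar\tau)(v'_1)\},$$ $$\Gamma(x')=\bigcup_{v'_1\in\mathbb{R}^n}\{w'\in\mathbb{R}^d\mid(-x',w')\in\nabla G(\bar x,\bar w)^*v'_1+D^*M(\bar\tau)(v'_1)\},$$ and therefore $$D^*S(\bar w|\bar x)(x')=\bigcup_{v'_1\in\mathbb{R}^n}\{w'\in\mathbb{R}^d\mid(-x',w')=\nabla G(\bar x,\bar w)^*v'_1\}.$$ In particular, $$D^*S(\bar w|\bar x)(0)=\{w'\in\mathbb{R}^d\mid\exists v'_1\in\mathbb{R}^n\text{ with }(0,w')=\nabla G(\bar x,\bar w)^*v'_1\}.$$ Moreover (still under (CQ)), $S$ is locally Lipschitz-like around $(\bar w,\bar x)$ if and only if $D^*S(\bar w|\bar x)(0)=\{0\}$, that is, $$\{w'\in\mathbb{R}^d\mid\exists v'_1\in\mathbb{R}^n\text{ with }\nabla^2_{xx}f_0(\bar x,\bar w)v'_1=0,\ w'=\nabla^2_{wx}f_0(\bar x,\bar w)v'_1\}=\{0\},$$ and this is fulfilled if and only if $$\ker\nabla^2_{xx}f_0(\bar x,\bar w)\subset\ker\nabla^2_{wx}f_0(\bar x,\bar w).\qquad(\mathrm{I})$$ (3) The constraint qualification (CQ) is equivalent to $$\ker\nabla^2_{xx}f_0(\bar x,\bar w)\cap\ker\nabla^2_{wx}f_0(\bar x,\bar w)=\{0\}.\qquad(\mathrm{K})$$ Thus, if (K) is satisfied, then $S$ is locally Lipschitz-like around $(\bar w,\bar x)$ if and only if (I) holds.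
   Context: Fréchet normal cone: for $\Omega\subset\mathbb{R}^s$ and $\bar v\in\Omega$, $\widehat N_\Omega(\bar v)=\{v'\in\mathbb{R}^s\mid\limsup_{v\to\bar v,\,v\in\Omega}\frac{\langle v',v-\bar v\rangle}{\|v-\bar v\|}\le 0\}$, and $\widehat N_\Omega(\bar v)=\emptyset$ if $\bar v\notin\Omega$. Mordukhovich (limiting) normal cone, for $\Omega$ locally closed around $\bar v\in\Omega$: $N_\Omega(\bar v)$ is the set of all $v'$ for which there are sequences $v_k\to\bar v$, $v'_k\to v'$ with $v'_k\in\widehat N_\Omega(v_k)$ for all $k$; $N_\Omega(\bar v)=\emptyset$ if $\bar v\notin\Omega$. For a multifunction $\Phi$ between Euclidean spaces and $\bar z=(\bar u,\bar y)\in\mathrm{gph}\,\Phi=\{(u,y)\mid y\in\Phi(u)\}$, the Fréchet and Mordukhovich coderivatives are $\widehat D^*\Phi(\bar z)(y')=\{u'\mid(u',-y')\in\widehat N_{\mathrm{gph}\,\Phi}(\bar z)\}$ and $D^*\Phi(\bar z)(y')=\{u'\mid(u',-y')\in N_{\mathrm{gph}\,\Phi}(\bar z)\}$. Here $M:\mathbb{R}^n\times\mathbb{R}^d\rightrightarrows\mathbb{R}^n$ and $S:\mathbb{R}^d\rightrightarrows\mathbb{R}^n$; $D^*S(\bar w|\bar x)$ denotes $D^*S$ at the point $(\bar w,\bar x)$ of its graph. $\Phi$ is graphically regular at $\bar z$ if $N_{\mathrm{gph}\,\Phi}(\bar z)=\widehat N_{\mathrm{gph}\,\Phi}(\bar z)$.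 $S$ is locally Lipschitz-like around $(\bar w,\bar x)\in\mathrm{gph}\,S$ if there exist $\ell>0$ and neighborhoods $U$ of $\bar x$, $V$ of $\bar w$ such that $S(w')\cap U\subset S(w)+\ell\|w'-w\|\bar B$ for all $w,w'\in V$, where $\bar B$ is the closed unit ball of $\mathbb{R}^n$. $\nabla^2_{xx}f_0(\bar x,\bar w)$ is the $n\times n$ Hessian in $x$, and $\nabla^2_{wx}f_0(\bar x,\bar w)$ is the $d\times n$ matrix with entries $\partial^2f_0/\partial w_i\partial x_j$ at $(\bar x,\bar w)$. The adjoint of the derivative of $G$ acts by $\nabla G(\bar x,\bar w)^*v'_1=(\nabla^2_{xx}f_0(\bar x,\bar w)v'_1,\nabla^2_{wx}f_0(\bar x,\bar w)v'_1)\in\mathbb{R}^n\times\mathbb{R}^d$. *)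

theory Defs
  imports "HOL-Analysis.Analysis" "HOL-Library.Set_Algebras"
begin

subsection \<open>Normal cones\<close>

text \<open>The filter \<open>at v within A\<close> excludes \<open>v\<close> itself, where the quotient is not defined. It is trivial
  when \<open>v\<close> is isolated in \<open>A\<close>; the upper limit is then \<open>-\<infinity>\<close> and the cone is the whole space.\<close>

definition frechet_normal_cone :: "'a::euclidean_space set \<Rightarrow> 'a \<Rightarrow> 'a set" where
  "frechet_normal_cone A v =
     {v'. v \<in> A \<and>
          Limsup (at v within A) (\<lambda>u. ereal ((v' \<bullet> (u - v)) / norm (u - v))) \<le> 0}"

text \<open>The formula is meant for sets that are locally closed around \<open>v\<close>; this is not built into the
  definition.\<close>

definition limiting_normal_cone :: "'a::euclidean_space set \<Rightarrow> 'a \<Rightarrow> 'a set" where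
  "limiting_normal_cone A v =
     {v'. v \<in> A \<and>
          (\<exists>vs vs'. vs \<longlonglongrightarrow> v \<and> vs' \<longlonglongrightarrow> v' \<and> (\<forall>k::nat. vs' k \<in> frechet_normal_cone A (vs k)))}"

subsection \<open>Multifunctions\<close>

definition gph :: "('a \<Rightarrow> 'b set) \<Rightarrow> ('a \<times> 'b) set" where
  "gph \<Phi> = {(u, y). y \<in> \<Phi> u}"

definition frechet_coderivative ::
    "('a::euclidean_space \<Rightarrow> 'b::euclidean_space set) \<Rightarrow> 'a \<times> 'b \<Rightarrow> 'b \<Rightarrow> 'a set" where
  "frechet_coderivative \<Phi> z y' = {u'. (u', - y') \<in> frechet_normal_cone (gph \<Phi>) z}"

definition limiting_coderivative ::
    "('a::euclidean_space \<Rightarrow> 'b::euclidean_space set) \<Rightarrow> 'a \<times> 'b \<Rightarrow> 'b \<Rightarrow> 'a set" where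
  "limiting_coderivative \<Phi> z y' = {u'. (u', - y') \<in> limiting_normal_cone (gph \<Phi>) z}"

definition graphically_regular ::
    "('a::euclidean_space \<Rightarrow> 'b::euclidean_space set) \<Rightarrow> 'a \<times> 'b \<Rightarrow> bool" where
  "graphically_regular \<Phi> z \<longleftrightarrow>
     limiting_normal_cone (gph \<Phi>) z = frechet_normal_cone (gph \<Phi>) z"

text \<open>The sum of sets is the Minkowski sum; \<open>U\<close> and \<open>V\<close> are neighborhoods, not necessarily open.\<close>

definition locally_Lipschitz_like ::
    "('a::euclidean_space \<Rightarrow> 'b::euclidean_space set) \<Rightarrow> 'a \<times> 'b \<Rightarrow> bool" where
  "locally_Lipschitz_like \<Phi> z \<longleftrightarrow>
     (\<exists>l>0. \<exists>U V. snd z \<in> interior U \<and> fst z \<in> interior V \<and>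
        (\<forall>w\<in>V. \<forall>w'\<in>V.
           \<Phi> w' \<inter> U \<subseteq> \<Phi> w + (\<lambda>b. (l * norm (w' - w)) *\<^sub>R b) ` cball 0 1))"

subsection \<open>Derivatives of a function of two variables\<close>

definition twice_continuously_differentiable :: "('a::real_normed_vector \<Rightarrow> real) \<Rightarrow> bool" where
  "twice_continuously_differentiable f \<longleftrightarrow>
     (\<exists>(f' :: 'a \<Rightarrow> 'a \<Rightarrow>\<^sub>L real) (f'' :: 'a \<Rightarrow> 'a \<Rightarrow>\<^sub>L 'a \<Rightarrow>\<^sub>L real).
        (\<forall>z. (f has_derivative blinfun_apply (f' z)) (at z)) \<and>
        (\<forall>z. (f' has_derivative blinfun_apply (f'' z)) (at z)) \<and>
        continuous_on UNIV f'')"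

definition directional_deriv :: "'a::real_normed_vector \<Rightarrow> ('a \<Rightarrow> real) \<Rightarrow> 'a \<Rightarrow> real" where
  "directional_deriv b f z = deriv (\<lambda>t. f (z + t *\<^sub>R b)) 0"

abbreviation partial_x :: "'n \<Rightarrow> ((real^'n) \<times> (real^'d) \<Rightarrow> real) \<Rightarrow> (real^'n) \<times> (real^'d) \<Rightarrow> real" where
  "partial_x i \<equiv> directional_deriv (axis i 1, 0)"

abbreviation partial_w :: "'d \<Rightarrow> ((real^'n) \<times> (real^'d) \<Rightarrow> real) \<Rightarrow> (real^'n) \<times> (real^'d) \<Rightarrow> real" where
  "partial_w i \<equiv> directional_deriv (0, axis i 1)"

definition grad_x :: "((real^'n) \<times> (real^'d) \<Rightarrow> real) \<Rightarrow> (real^'n) \<times> (real^'d) \<Rightarrow> real^'n" where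
  "grad_x f z = (\<chi> j. partial_x j f z)"

definition hessian_xx :: "((real^'n) \<times> (real^'d) \<Rightarrow> real) \<Rightarrow> (real^'n) \<times> (real^'d) \<Rightarrow> real^'n^'n" where
  "hessian_xx f z = (\<chi> i j. partial_x i (partial_x j f) z)"

definition hessian_wx :: "((real^'n) \<times> (real^'d) \<Rightarrow> real) \<Rightarrow> (real^'n) \<times> (real^'d) \<Rightarrow> real^'n^'d" where
  "hessian_wx f z = (\<chi> i j. partial_w i (partial_x j f) z)"

definition matrix_ker :: "real^'n^'m \<Rightarrow> (real^'n) set" where
  "matrix_ker A = {v. A *v v = 0}"

subsection \<open>The parametric generalized equation\<close>

definition feasible_set :: "('a \<times> 'b \<Rightarrow> real) \<Rightarrow> 'b \<Rightarrow> 'a set" where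
  "feasible_set F w = {x. F (x, w) \<le> 0}"

text \<open>For \<open>(x, w)\<close> this is the limiting normal cone to the feasible set of \<open>w\<close> at \<open>x\<close>,
  empty when \<open>x\<close> is infeasible.\<close>

definition normal_map :: "('a::euclidean_space \<times> 'b \<Rightarrow> real) \<Rightarrow> 'a \<times> 'b \<Rightarrow> 'a set" where
  "normal_map F = (\<lambda>(x, w). limiting_normal_cone (feasible_set F w) x)"

text \<open>\<open>a +o B\<close> is the translate of the set \<open>B\<close> by \<open>a\<close>.\<close>

definition solution_map ::
    "((real^'n) \<times> (real^'d) \<Rightarrow> real) \<Rightarrow> ((real^'n) \<times> (real^'d) \<Rightarrow> real) \<Rightarrow> real^'d \<Rightarrow> (real^'n) set" where
  "solution_map f0 F w = {x. 0 \<in> grad_x f0 (x, w) +o normal_map F (x, w)}"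

end

theory Submission
  imports Defs
begin

text \<open>Where \<open>F < 0\<close> the normal cone to the feasible set is trivial, so near the reference points the graph
  of \<open>M\<close> is the zero set of the projection \<open>snd\<close> and the graph of \<open>S\<close> is, up to swapping the
  coordinates, the zero set of \<open>G\<close>; under (CQ) the derivative of \<open>G\<close> is onto. For a zero set of a strictly
  differentiable map with surjective derivative \<open>A\<close> both normal cones equal the range of the adjoint of \<open>A\<close>:
  a point \<open>z + t h\<close> with \<open>A h = 0\<close> can be corrected to a point of the zero set at a cost \<open>o(t)\<close> that is
  uniform in \<open>z\<close>, so every limiting normal annihilates the kernel of \<open>A\<close>. If the kernel of the
  Hessian in \<open>x\<close> is trivial, the same correction can be made in \<open>x\<close> alone, which is the Lipschitz-like
  property; conversely the latter excludes nonzero Frechet normals of the form \<open>(w', 0)\<close>.\<close>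

subsection \<open>Normal cones\<close>

text \<open>Clearing the denominator turns the upper limit into an epsilon-delta inequality that is
  trivial at \<open>u = v\<close>, so it can be asked on all of \<open>A\<close>; an isolated
  \<open>v\<close> fits as well. The strict bound \<open>q u < e\<close> is recovered from the
  non-strict one by halving \<open>e\<close>.\<close>

lemma frechet_normal_cone_iff:
  fixes v :: "'a::euclidean_space"
  shows "v' \<in> frechet_normal_cone A v \<longleftrightarrow>
    v \<in> A \<and> (\<forall>e>0. \<exists>d>0. \<forall>u\<in>A. norm (u - v) < d \<longrightarrow> v' \<bullet> (u - v) \<le> e * norm (u - v))"
    (is "_ \<longleftrightarrow> _ \<and> ?R")
proof -
  define q where "q u = (v' \<bullet> (u - v)) / norm (u - v)" for u
  have "Limsup (at v within A) (\<lambda>u. ereal (q u)) \<le> 0 \<longleftrightarrow>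
        (\<forall>e>0. eventually (\<lambda>u. q u < e) (at v within A))"
    unfolding Limsup_le_iff
  proof safe
    fix e :: real assume *: "\<forall>y>0. \<forall>\<^sub>F x in at v within A. ereal (q x) < y" "e > 0"
    show "eventually (\<lambda>u. q u < e) (at v within A)"
      using *(1)[rule_format, of "ereal e"] \<open>e > 0\<close> by simp
  next
    fix y :: ereal assume *: "\<forall>e>0. \<forall>\<^sub>F u in at v within A. q u < e" "y > 0"
    then obtain e where "e > 0" "ereal e < y" by (metis ereal_dense2 ereal_less(2))
    then have "\<forall>\<^sub>F u in at v within A. q u < e" using *(1) by blast
    then show "\<forall>\<^sub>F u in at v within A. ereal (q u) < y"
    proof eventually_elim
      case (elim u)
      then have "ereal (q u) < ereal e" by simp
      then show ?case using \<open>ereal e < y\<close> by (rule less_trans)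
    qed
  qed
  also have "\<dots> \<longleftrightarrow> ?R"
  proof safe
    fix e :: real assume *: "\<forall>e>0. \<forall>\<^sub>F u in at v within A. q u < e" "e > 0"
    then obtain d where d: "d > 0" "\<forall>u\<in>A. 0 < dist u v \<and> dist u v < d \<longrightarrow> q u < e"
      unfolding eventually_at by (metis zero_less_dist_iff)
    have "v' \<bullet> (u - v) \<le> e * norm (u - v)" if "u \<in> A" "norm (u - v) < d" for u
    proof (cases "u = v")
      case False
      then have "q u < e" using d that by (simp add: dist_norm)
      then show ?thesis using False by (simp add: q_def field_simps)
    qed simp
    then show "\<exists>d>0. \<forall>u\<in>A. norm (u - v) < d \<longrightarrow> v' \<bullet> (u - v) \<le> e * norm (u - v)"
      using d(1) by blast
  next
    fix e :: real assume *: ?R "e > 0"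
    then obtain d where d: "d > 0"
      "\<forall>u\<in>A. norm (u - v) < d \<longrightarrow> v' \<bullet> (u - v) \<le> e / 2 * norm (u - v)"
      by (meson half_gt_zero)
    have "q u < e" if "u \<in> A" "u \<noteq> v" "dist u v < d" for u
    proof -
      have "q u \<le> e / 2" using d that by (simp add: q_def dist_norm field_simps)
      then show ?thesis using \<open>e > 0\<close> by simp
    qed
    then show "\<forall>\<^sub>F u in at v within A. q u < e"
      unfolding eventually_at using d(1) by blast
  qed
  finally show ?thesis by (simp add: frechet_normal_cone_def q_def)
qed

lemma frechet_subset_limiting_normal_cone: "frechet_normal_cone A v \<subseteq> limiting_normal_cone A v"
proof
  fix v' assume "v' \<in> frechet_normal_cone A v"
  then show "v' \<in> limiting_normal_cone A v"
    unfolding limiting_normal_cone_def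
    by (intro CollectI conjI exI[of _ "\<lambda>_. v"] exI[of _ "\<lambda>_. v'"])
      (auto simp: frechet_normal_cone_def)
qed

text \<open>A nonzero normal \<open>v'\<close> is tested in its own direction:
  \<open>v + t *\<^sub>R v'\<close> stays in \<open>A\<close> for small \<open>t > 0\<close>, and
  there the quotient equals \<open>norm v'\<close>, which exceeds the tolerance
  \<open>norm v' / 2\<close>.\<close>

lemma frechet_normal_cone_interior:
  fixes v :: "'a::euclidean_space"
  assumes "v \<in> interior A"
  shows "frechet_normal_cone A v = {0}"
proof safe
  fix v' assume v': "v' \<in> frechet_normal_cone A v"
  obtain r where r: "r > 0" "ball v r \<subseteq> A" using assms mem_interior by blast
  show "v' = 0"
  proof (rule ccontr)
    assume nz: "v' \<noteq> 0"
    then obtain d where d: "d > 0"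
      "\<forall>u\<in>A. norm (u - v) < d \<longrightarrow> v' \<bullet> (u - v) \<le> norm v' / 2 * norm (u - v)"
      using v' unfolding frechet_normal_cone_iff by (meson half_gt_zero zero_less_norm_iff)
    define t where "t = min d r / (2 * norm v')"
    have t: "t > 0" "t * norm v' < d" "t * norm v' < r"
      using nz r d by (auto simp: t_def)
    have "v + t *\<^sub>R v' \<in> A" using r t by (auto simp: subset_iff dist_norm)
    then have "t * (v' \<bullet> v') \<le> norm v' / 2 * (t * norm v')"
      using d(2)[rule_format, of "v + t *\<^sub>R v'"] t by simp
    then have "t * (norm v')\<^sup>2 \<le> t * (norm v')\<^sup>2 / 2"
      by (simp add: power2_norm_eq_inner[symmetric] power2_eq_square algebra_simps)
    moreover have "t * (norm v')\<^sup>2 > 0" using t nz by simp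
    ultimately show False by simp
  qed
next
  show "0 \<in> frechet_normal_cone A v"
    using assms interior_subset by (auto simp: frechet_normal_cone_iff intro: exI[of _ 1])
qed

text \<open>A sequence converging to \<open>v\<close> eventually runs in the interior, where all
  Frechet normals vanish.\<close>

lemma limiting_normal_cone_interior:
  fixes v :: "'a::euclidean_space"
  assumes "v \<in> interior A"
  shows "limiting_normal_cone A v = {0}"
proof
  show "limiting_normal_cone A v \<subseteq> {0}"
  proof
    fix v' assume "v' \<in> limiting_normal_cone A v"
    then obtain vs vs' where vs: "vs \<longlonglongrightarrow> v" "vs' \<longlonglongrightarrow> v'"
      "\<And>k. vs' k \<in> frechet_normal_cone A (vs k)"
      unfolding limiting_normal_cone_def by blast
    have "eventually (\<lambda>k. vs k \<in> interior A) sequentially"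
      using vs(1) assms topological_tendstoD by blast
    then have "eventually (\<lambda>k. vs' k = 0) sequentially"
      by eventually_elim (use vs(3) frechet_normal_cone_interior in blast)
    then have "vs' \<longlonglongrightarrow> 0" by (rule tendsto_eventually)
    then show "v' \<in> {0}" using vs(2) LIMSEQ_unique by blast
  qed
  show "{0} \<subseteq> limiting_normal_cone A v"
    using frechet_subset_limiting_normal_cone frechet_normal_cone_interior[OF assms] by blast
qed

subsection \<open>Strict differentiability and level sets\<close>

text \<open>Both points vary: near \<open>z\<close> the remainder \<open>g - A\<close> is Lipschitz
  with arbitrarily small constant. This gives the contraction in the correction argument and
  estimates at base points other than \<open>z\<close>. Linearity of \<open>A\<close> is supplied
  separately.\<close>

definition has_strict_derivative ::
    "('a::real_normed_vector \<Rightarrow> 'b::real_normed_vector) \<Rightarrow> ('a \<Rightarrow> 'b) \<Rightarrow> 'a \<Rightarrow> bool" where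
  "has_strict_derivative g A z \<longleftrightarrow>
     (\<forall>e>0. \<exists>d>0. \<forall>x\<in>ball z d. \<forall>y\<in>ball z d. norm (g x - g y - A (x - y)) \<le> e * norm (x - y))"

lemma has_strict_derivativeD:
  assumes "has_strict_derivative g A z" "e > 0"
  obtains d where "d > 0"
    "\<And>x y. x \<in> ball z d \<Longrightarrow> y \<in> ball z d \<Longrightarrow> norm (g x - g y - A (x - y)) \<le> e * norm (x - y)"
  using assms unfolding has_strict_derivative_def by metis

text \<open>Mean value inequality for \<open>f - f' z\<close> on a ball where \<open>f'\<close>
  differs from \<open>f' z\<close> by less than \<open>e\<close>.\<close>

lemma C1_has_strict_derivative:
  fixes f :: "'a::real_normed_vector \<Rightarrow> 'b::real_normed_vector" and f' :: "'a \<Rightarrow> 'a \<Rightarrow>\<^sub>L 'b"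
  assumes f': "\<And>z. (f has_derivative blinfun_apply (f' z)) (at z)"
    and cont: "continuous_on UNIV f'"
  shows "has_strict_derivative f (f' z) z"
  unfolding has_strict_derivative_def
proof (intro allI impI)
  fix e :: real assume e: "e > 0"
  have "isCont f' z" using cont by (simp add: continuous_on_eq_continuous_at)
  then obtain d where d: "d > 0" "\<And>x. dist x z < d \<Longrightarrow> dist (f' x) (f' z) < e"
    using e unfolding continuous_at_eps_delta by blast
  have "norm (f x - f y - f' z (x - y)) \<le> e * norm (x - y)"
    if xy: "x \<in> ball z d" "y \<in> ball z d" for x y
  proof -
    have "norm (f x - f y - f' z (x - y)) \<le> norm (x - y) * e"
    proof (rule differentiable_bound_linearization[where S = "ball z d" and f' = "\<lambda>z. blinfun_apply (f' z)"])
      fix t :: real assume "t \<in> {0..1}"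
      then show "y + t *\<^sub>R (x - y) \<in> ball z d"
        using convexD_alt[OF convex_ball xy(2,1), of t] by (simp add: algebra_simps)
    next
      fix u assume "u \<in> ball z d"
      then have "norm (f' u - f' z) \<le> e" using d(2)[of u] by (simp add: dist_commute dist_norm)
      moreover have "blinfun_apply (f' u) - blinfun_apply (f' z) = blinfun_apply (f' u - f' z)"
        by (simp add: fun_eq_iff blinfun.diff_left)
      ultimately show "onorm (blinfun_apply (f' u) - blinfun_apply (f' z)) \<le> e"
        by (simp add: norm_blinfun.rep_eq)
    qed (use d(1) f' in \<open>auto intro: has_derivative_at_withinI\<close>)
    then show ?thesis by (simp add: mult.commute)
  qed
  then show "\<exists>d>0. \<forall>x\<in>ball z d. \<forall>y\<in>ball z d. norm (f x - f y - f' z (x - y)) \<le> e * norm (x - y)"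
    using d(1) by blast
qed

lemma linear_has_strict_derivative: "linear A \<Longrightarrow> has_strict_derivative A A z"
  unfolding has_strict_derivative_def by (auto simp: linear_diff intro: exI[of _ 1])

lemma has_strict_derivative_bounded_linear_comp:
  assumes L: "bounded_linear L" and g: "has_strict_derivative g A z"
  shows "has_strict_derivative (\<lambda>x. L (g x)) (\<lambda>h. L (A h)) z"
  unfolding has_strict_derivative_def
proof (intro allI impI)
  fix e :: real assume e: "e > 0"
  obtain K where K: "K > 0" "\<And>x. norm (L x) \<le> norm x * K"
    using bounded_linear.pos_bounded[OF L] by blast
  obtain d where d: "d > 0"
    "\<And>x y. x \<in> ball z d \<Longrightarrow> y \<in> ball z d \<Longrightarrow> norm (g x - g y - A (x - y)) \<le> (e / K) * norm (x - y)"
    using has_strict_derivativeD[OF g, of "e / K"] e K by auto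
  have "norm (L (g x) - L (g y) - L (A (x - y))) \<le> e * norm (x - y)"
    if "x \<in> ball z d" "y \<in> ball z d" for x y
  proof -
    have "L (g x) - L (g y) - L (A (x - y)) = L (g x - g y - A (x - y))"
      using L by (simp add: linear_diff bounded_linear.linear)
    also have "norm \<dots> \<le> norm (g x - g y - A (x - y)) * K" by (rule K)
    also have "\<dots> \<le> (e / K * norm (x - y)) * K"
      using d(2)[OF that] K by (intro mult_right_mono) auto
    finally show ?thesis using K by simp
  qed
  then show "\<exists>d>0. \<forall>x\<in>ball z d. \<forall>y\<in>ball z d. norm (L (g x) - L (g y) - L (A (x - y))) \<le> e * norm (x - y)"
    using d(1) by blast
qed

text \<open>\<open>G\<close> takes \<open>(x, w)\<close>, whereas points of the graph of
  \<open>S\<close> are \<open>(w, x)\<close>. Swapping is a linear isometry, so the estimate carries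
  over with the same \<open>d\<close>.\<close>

lemma has_strict_derivative_swap:
  fixes g A :: "'a::real_normed_vector \<times> 'b::real_normed_vector \<Rightarrow> 'c::real_normed_vector"
  assumes "has_strict_derivative g A (x, w)"
  shows "has_strict_derivative (g \<circ> prod.swap) (A \<circ> prod.swap) (w, x)"
  unfolding has_strict_derivative_def
proof (intro allI impI)
  have norm_swap: "norm (prod.swap p) = norm p" for p :: "'b \<times> 'a"
    by (cases p) (simp add: norm_Pair add.commute)
  fix e :: real assume "e > 0"
  then obtain d where d: "d > 0"
    "\<And>p q. p \<in> ball (x, w) d \<Longrightarrow> q \<in> ball (x, w) d \<Longrightarrow> norm (g p - g q - A (p - q)) \<le> e * norm (p - q)"
    using has_strict_derivativeD[OF assms] by metis
  have "norm ((g \<circ> prod.swap) p - (g \<circ> prod.swap) q - (A \<circ> prod.swap) (p - q)) \<le> e * norm (p - q)"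
    if "p \<in> ball (w, x) d" "q \<in> ball (w, x) d" for p q
  proof -
    have sw: "prod.swap p - prod.swap q = prod.swap (p - q)" for p q :: "'b \<times> 'a"
      by (simp add: prod_eq_iff)
    have b: "prod.swap p \<in> ball (x, w) d" if "p \<in> ball (w, x) d" for p
      using that norm_swap[of "(w, x) - p"] sw[of "(w, x)" p] by (simp add: dist_norm)
    show ?thesis using d(2)[OF b b, OF that] by (simp add: sw norm_swap)
  qed
  then show "\<exists>d>0. \<forall>p\<in>ball (w, x) d. \<forall>q\<in>ball (w, x) d.
      norm ((g \<circ> prod.swap) p - (g \<circ> prod.swap) q - (A \<circ> prod.swap) (p - q)) \<le> e * norm (p - q)"
    using d(1) by blast
qed

text \<open>The Lyusternik--Graves correction: \<open>y\<close> is the fixed point of the contraction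
  \<open>y \<mapsto> y - g (z + R y)\<close> on the ball of radius \<open>2 * norm (g z)\<close>.\<close>

lemma level_set_correction:
  fixes g :: "'a::euclidean_space \<Rightarrow> 'b::euclidean_space"
  assumes strict: "has_strict_derivative g A z0" and A: "linear A" and R: "linear R"
    and AR: "\<And>y. A (R y) = y" and z0: "g z0 = 0"
  obtains r where "r > 0"
    "\<And>z. z \<in> ball z0 r \<Longrightarrow> \<exists>y. norm y \<le> 2 * norm (g z) \<and> g (z + R y) = 0"
proof -
  obtain K where K: "K > 0" "\<And>y. norm (R y) \<le> K * norm y" using linear_bounded_pos[OF R] by blast
  obtain B where B: "B > 0" "\<And>y. norm (A y) \<le> B * norm y" using linear_bounded_pos[OF A] by blast
  \<comment> \<open>Since \<open>R\<close> expands by at most \<open>K\<close>, this tolerance gives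
    the contraction factor \<open>e * K = 1 / 2\<close>.\<close>
  define e where "e = 1 / (2 * K)"
  have e: "e > 0" using K by (simp add: e_def)
  obtain d where d: "d > 0"
    "\<And>x y. x \<in> ball z0 d \<Longrightarrow> y \<in> ball z0 d \<Longrightarrow> norm (g x - g y - A (x - y)) \<le> e * norm (x - y)"
    using has_strict_derivativeD[OF strict e] by metis
  \<comment> \<open>As \<open>norm (g z) \<le> (e + B) * r\<close> on the ball, the second bound
    keeps \<open>R y\<close> within \<open>d / 2\<close> for
    \<open>norm y \<le> 2 * norm (g z)\<close>; the first leaves the other half of \<open>d\<close>
    to \<open>z\<close>.\<close>
  define r where "r = min (d / 2) (d / (4 * K * (e + B)))"
  have r: "r > 0" "r \<le> d / 2" "2 * K * ((e + B) * r) \<le> d / 2"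
  proof -
    show "r > 0" "r \<le> d / 2" using d K B e by (auto simp: r_def)
    have "r \<le> d / (4 * K * (e + B))" by (simp add: r_def)
    moreover have "4 * K * (e + B) > 0" using K B e by simp
    ultimately have "r * (4 * K * (e + B)) \<le> d" by (simp only: pos_le_divide_eq)
    then show "2 * K * ((e + B) * r) \<le> d / 2" by (simp add: algebra_simps)
  qed
  have "\<exists>y. norm y \<le> 2 * norm (g z) \<and> g (z + R y) = 0" if z: "z \<in> ball z0 r" for z
  proof -
    define S where "S = cball (0::'b) (2 * norm (g z))"
    define h where "h y = y - g (z + R y)" for y
    have zd: "z \<in> ball z0 d" using z r d by auto
    have "norm (g z) \<le> (e + B) * norm (z - z0)"
    proof -
      have "norm (g z) \<le> norm (g z - g z0 - A (z - z0)) + norm (A (z - z0))"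
        using z0 norm_triangle_sub[of "g z" "A (z - z0)"] by simp
      also have "\<dots> \<le> e * norm (z - z0) + B * norm (z - z0)"
        using d(2)[OF zd, of z0] d(1) B(2)[of "z - z0"] by simp
      finally show ?thesis by (simp add: algebra_simps)
    qed
    also have "\<dots> \<le> (e + B) * r" using z e B by (intro mult_left_mono) (auto simp: dist_norm norm_minus_commute)
    finally have gz: "norm (g z) \<le> (e + B) * r" .
    have S: "z + R y \<in> ball z0 d" if "y \<in> S" for y
    proof -
      have "norm (R y) \<le> K * norm y" by (rule K)
      also have "\<dots> \<le> K * (2 * norm (g z))" using that K(1) by (intro mult_left_mono) (auto simp: S_def)
      also have "\<dots> \<le> K * (2 * ((e + B) * r))" using gz K(1) by (intro mult_left_mono) auto
      also have "\<dots> \<le> d / 2" using r(3) by (simp add: algebra_simps)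
      finally have "norm (R y) \<le> d / 2" .
      moreover have "norm (z - z0) < d / 2" using z r by (simp add: dist_norm norm_minus_commute)
      ultimately have "norm (z - z0 + R y) < d" using norm_triangle_ineq[of "z - z0" "R y"] by linarith
      then show ?thesis by (simp add: dist_norm norm_minus_commute algebra_simps)
    qed
    have contr: "norm (h y1 - h y2) \<le> 1 / 2 * norm (y1 - y2)" if "y1 \<in> S" "y2 \<in> S" for y1 y2
    proof -
      have "A (z + R y1 - (z + R y2)) = y1 - y2" using AR A by (simp add: linear_diff)
      then have "h y1 - h y2 = - (g (z + R y1) - g (z + R y2) - A (z + R y1 - (z + R y2)))"
        unfolding h_def by simp
      then have "norm (h y1 - h y2) = norm (g (z + R y1) - g (z + R y2) - A (z + R y1 - (z + R y2)))"
        by (simp only: norm_minus_cancel)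
      also have "\<dots> \<le> e * norm (z + R y1 - (z + R y2))" using that by (intro d(2) S)
      also have "\<dots> = e * norm (R (y1 - y2))" using R by (simp add: linear_diff)
      also have "\<dots> \<le> e * (K * norm (y1 - y2))" using K e by (intro mult_left_mono) auto
      finally show ?thesis using K by (simp add: e_def)
    qed
    have 0: "0 \<in> S" by (simp add: S_def)
    \<comment> \<open>\<open>h 0 = - g z\<close>, so a point of norm at most
      \<open>2 * norm (g z)\<close> is sent to one of norm at most half of that plus
      \<open>norm (g z)\<close>.\<close>
    have "h ` S \<subseteq> S"
    proof safe
      fix y assume y: "y \<in> S"
      have "norm (h y) \<le> norm (h y - h 0) + norm (h 0)" using norm_triangle_sub[of "h y" "h 0"] by simp
      also have "\<dots> \<le> 1 / 2 * norm y + norm (g z)"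
        using contr[OF y 0] R by (simp add: h_def linear_0)
      finally show "h y \<in> S" using y by (simp add: S_def)
    qed
    then obtain y where "y \<in> S" "h y = y"
      using Banach_fix[of S "1/2" h] 0 contr by (auto simp: S_def dist_norm complete_eq_closed)
    then show ?thesis by (auto simp: h_def S_def)
  qed
  then show thesis using that r(1) by blast
qed

section \<open>Normal cones to level sets\<close>

lemma surj_right_inverse:
  assumes "linear (A :: 'a::euclidean_space \<Rightarrow> 'b::euclidean_space)" "surj A"
  obtains R where "linear R" "\<And>y. A (R y) = y"
  using linear_surjective_right_inverse[OF assms] by (metis comp_apply id_apply)

text \<open>Along the level set \<open>A (u - z0)\<close> is \<open>o(norm (u - z0))\<close>, and
  \<open>adjoint A v \<bullet> (u - z0) = v \<bullet> A (u - z0)\<close>.\<close>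

lemma range_adjoint_subset_frechet_normal_cone:
  fixes g :: "'a::euclidean_space \<Rightarrow> 'b::euclidean_space"
  assumes strict: "has_strict_derivative g A z0" and A: "linear A"
    and U: "open U" "z0 \<in> U" and z0: "g z0 = 0" and \<Omega>: "\<Omega> \<inter> U = {z \<in> U. g z = 0}"
  shows "range (adjoint A) \<subseteq> frechet_normal_cone \<Omega> z0"
proof safe
  fix v
  have "\<exists>d>0. \<forall>u\<in>\<Omega>. norm (u - z0) < d \<longrightarrow> adjoint A v \<bullet> (u - z0) \<le> e * norm (u - z0)"
    if e: "e > 0" for e :: real
  proof -
    \<comment> \<open>The summand 1 covers \<open>v = 0\<close>.\<close>
    define e' where "e' = e / (norm v + 1)"
    have e': "e' > 0" "norm v * e' \<le> e"
      using e by (auto simp: e'_def field_simps add_pos_nonneg add_nonneg_pos)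
    obtain d where d: "d > 0"
      "\<And>x y. x \<in> ball z0 d \<Longrightarrow> y \<in> ball z0 d \<Longrightarrow> norm (g x - g y - A (x - y)) \<le> e' * norm (x - y)"
      using has_strict_derivativeD[OF strict e'(1)] by metis
    obtain \<rho> where \<rho>: "\<rho> > 0" "ball z0 \<rho> \<subseteq> U" using U open_contains_ball by blast
    have "adjoint A v \<bullet> (u - z0) \<le> e * norm (u - z0)"
      if u: "u \<in> \<Omega>" "norm (u - z0) < min d \<rho>" for u
    proof -
      have "u \<in> ball z0 d" "u \<in> U" using u \<rho> by (auto simp: dist_norm norm_minus_commute subset_iff)
      moreover have "g u = 0" using \<Omega> u \<open>u \<in> U\<close> by blast
      ultimately have "norm (A (u - z0)) \<le> e' * norm (u - z0)"
        using d(2)[of u z0] d(1) z0 by simp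
      then have "norm v * norm (A (u - z0)) \<le> norm v * (e' * norm (u - z0))"
        by (intro mult_left_mono) auto
      moreover have "adjoint A v \<bullet> (u - z0) \<le> norm v * norm (A (u - z0))"
        using A by (simp add: adjoint_clauses norm_cauchy_schwarz)
      moreover have "norm v * e' * norm (u - z0) \<le> e * norm (u - z0)"
        using e'(2) by (intro mult_right_mono) auto
      ultimately show ?thesis by (simp add: mult.assoc)
    qed
    then show ?thesis using d(1) \<rho>(1) by (intro exI[of _ "min d \<rho>"]) auto
  qed
  moreover have "z0 \<in> \<Omega>" using \<Omega> U z0 by blast
  ultimately show "adjoint A v \<in> frechet_normal_cone \<Omega> z0"
    unfolding frechet_normal_cone_iff by blast
qed

text \<open>From \<open>z\<close> one moves by \<open>t *\<^sub>R h\<close>, along which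
  \<open>g\<close> changes by at most \<open>e * t * norm h\<close>, and returns to the level set by
  \<open>R y\<close> of norm at most \<open>2 * K * e * t * norm h\<close>. The normal inequality at
  the corrected point, divided by \<open>t\<close>, gives the bound. The term with
  \<open>norm v\<close> is the cost of the correction; \<rho> depends neither on \<open>z\<close>
  nor on \<open>v\<close>, so limits can be taken.\<close>

lemma frechet_normal_near_level_set:
  fixes g :: "'a::euclidean_space \<Rightarrow> 'b::euclidean_space"
  assumes strict: "has_strict_derivative g A z0" and A: "linear A"
    and R: "linear R" "\<And>y. A (R y) = y" and K: "K > 0" "\<And>y. norm (R y) \<le> K * norm y"
    and U: "open U" "z0 \<in> U" and z0: "g z0 = 0" and \<Omega>: "\<Omega> \<inter> U = {z \<in> U. g z = 0}"
    and e: "0 < e" "e \<le> 1" and h: "A h = 0"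
  obtains \<rho> where "\<rho> > 0"
    "\<And>z v. z \<in> ball z0 \<rho> \<Longrightarrow> v \<in> frechet_normal_cone \<Omega> z \<Longrightarrow>
       v \<bullet> h \<le> e * norm h * (1 + 2 * K + 2 * K * norm v)"
proof -
  obtain d where d: "d > 0"
    "\<And>x y. x \<in> ball z0 d \<Longrightarrow> y \<in> ball z0 d \<Longrightarrow> norm (g x - g y - A (x - y)) \<le> e * norm (x - y)"
    using has_strict_derivativeD[OF strict e(1)] by metis
  obtain r where r: "r > 0"
    "\<And>z. z \<in> ball z0 r \<Longrightarrow> \<exists>y. norm y \<le> 2 * norm (g z) \<and> g (z + R y) = 0"
    using level_set_correction[OF strict A R z0] by metis
  obtain s where s: "s > 0" "ball z0 s \<subseteq> U" using U open_contains_ball by blast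
  define \<rho> where "\<rho> = min d (min r s)"
  have \<rho>: "\<rho> > 0" "ball z0 \<rho> \<subseteq> ball z0 d" "ball z0 \<rho> \<subseteq> ball z0 r" "ball z0 \<rho> \<subseteq> U"
    using d r s by (auto simp: \<rho>_def subset_iff)
  have "v \<bullet> h \<le> e * norm h * (1 + 2 * K + 2 * K * norm v)"
    if z: "z \<in> ball z0 \<rho>" and v: "v \<in> frechet_normal_cone \<Omega> z" for z v
  proof -
    obtain m0 where m0: "m0 > 0"
      "\<And>u. u \<in> \<Omega> \<Longrightarrow> norm (u - z) < m0 \<Longrightarrow> v \<bullet> (u - z) \<le> e * norm (u - z)"
      using v e(1) unfolding frechet_normal_cone_iff by blast
    have "z \<in> \<Omega>" using v by (simp add: frechet_normal_cone_def)
    then have gz: "g z = 0" using z \<rho> \<Omega> by blast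
    define m where "m = min m0 (\<rho> - dist z0 z)"
    have m: "m > 0" "m \<le> m0" "m \<le> \<rho> - dist z0 z" using m0 z by (auto simp: m_def)
    \<comment> \<open>The corrected step has norm at most \<open>t * norm h * (1 + 2 * K)\<close>;
      with \<open>t * q = m / 2\<close> it stays below \<open>m\<close>, where both the normal
      inequality and the ball around \<open>z0\<close> are available. The summand 1 covers
      \<open>h = 0\<close>.\<close>
    define q where "q = norm h * (1 + 2 * K) + 1"
    have q: "q > 0" using K by (simp add: q_def add_nonneg_pos)
    define t where "t = m / (2 * q)"
    have t: "t > 0" using m q by (simp add: t_def)
    have "t * q = m / 2" using q by (simp add: t_def)
    then have tq: "t * (norm h * (1 + 2 * K)) < m" using m t by (simp add: q_def distrib_left)
    have near: "z + k \<in> ball z0 \<rho>" if "norm k < m" for k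
      using that m(3) norm_triangle_ineq4[of "z0 - z" k] by (simp add: dist_norm algebra_simps)
    have th_small: "norm (t *\<^sub>R h) < m"
    proof -
      have "norm h \<le> norm h * (1 + 2 * K)" using K by (simp add: distrib_left)
      then have "t * norm h \<le> t * (norm h * (1 + 2 * K))" using t by (intro mult_left_mono) auto
      then have "t * norm h < m" using tq by linarith
      then show ?thesis using t by simp
    qed
    have "norm (g (z + t *\<^sub>R h) - g z - A (z + t *\<^sub>R h - z)) \<le> e * norm (z + t *\<^sub>R h - z)"
      using near[OF th_small] z \<rho> by (intro d(2)) auto
    then have g1: "norm (g (z + t *\<^sub>R h)) \<le> e * (t * norm h)"
      using gz h A t by (simp add: linear_cmul)
    obtain y where y: "norm y \<le> 2 * norm (g (z + t *\<^sub>R h))" "g (z + t *\<^sub>R h + R y) = 0"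
      using r(2) near[OF th_small] \<rho> by blast
    have "norm (R y) \<le> K * norm y" by (rule K)
    also have "\<dots> \<le> K * (2 * (e * (t * norm h)))" using y g1 K by (intro mult_left_mono) auto
    finally have Ry: "norm (R y) \<le> K * (2 * (e * (t * norm h)))" .
    \<comment> \<open>Here \<open>e \<le> 1\<close> enters: it makes the length bound on the step
      free of \<open>e\<close>, so that \<open>e\<close> remains as a factor in the final
      estimate.\<close>
    have "K * (2 * (e * (t * norm h))) \<le> K * (2 * (1 * (t * norm h)))"
      using K t e by (intro mult_left_mono mult_right_mono) auto
    with Ry have Ry1: "norm (t *\<^sub>R h + R y) \<le> t * (norm h * (1 + 2 * K))"
      using norm_triangle_ineq[of "t *\<^sub>R h" "R y"] t by (simp add: algebra_simps)
    then have small: "norm (t *\<^sub>R h + R y) < m" using tq by linarith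
    have "z + (t *\<^sub>R h + R y) \<in> U" using near[OF small] \<rho> by blast
    then have "z + (t *\<^sub>R h + R y) \<in> \<Omega>" using y(2) \<Omega> by (auto simp: add.assoc)
    from m0(2)[OF this] small m have "v \<bullet> (t *\<^sub>R h + R y) \<le> e * norm (t *\<^sub>R h + R y)" by simp
    also have "\<dots> \<le> e * (t * (norm h * (1 + 2 * K)))" using Ry1 e by (intro mult_left_mono) auto
    finally have 1: "t * (v \<bullet> h) + v \<bullet> R y \<le> e * (t * (norm h * (1 + 2 * K)))"
      by (simp add: inner_add_right)
    have "- (v \<bullet> R y) \<le> norm v * norm (R y)"
      using norm_cauchy_schwarz[of v "- R y"] by simp
    also have "\<dots> \<le> norm v * (K * (2 * (e * (t * norm h))))" using Ry by (intro mult_left_mono) auto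
    finally have "t * (v \<bullet> h) \<le> t * (e * norm h * (1 + 2 * K + 2 * K * norm v))"
      using 1 by (simp add: algebra_simps)
    then show ?thesis using t by (simp only: mult_le_cancel_left_pos)
  qed
  then show thesis using that \<rho>(1) by blast
qed

text \<open>The uniform estimate survives the limit because \<open>norm (vs k)\<close> converges,
  and then \<open>e\<close> tends to 0. The kernel of \<open>A\<close> contains \<open>- h\<close>
  with \<open>h\<close>, so the limiting normal is orthogonal to it, hence lies in the range of the
  adjoint.\<close>

lemma limiting_normal_cone_level_set_subset:
  fixes g :: "'a::euclidean_space \<Rightarrow> 'b::euclidean_space"
  assumes strict: "has_strict_derivative g A z0" and A: "linear A" "surj A"
    and U: "open U" "z0 \<in> U" and z0: "g z0 = 0" and \<Omega>: "\<Omega> \<inter> U = {z \<in> U. g z = 0}"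
  shows "limiting_normal_cone \<Omega> z0 \<subseteq> range (adjoint A)"
proof
  fix v assume "v \<in> limiting_normal_cone \<Omega> z0"
  then obtain zs vs where zs: "zs \<longlonglongrightarrow> z0" "vs \<longlonglongrightarrow> v"
    "\<And>k. vs k \<in> frechet_normal_cone \<Omega> (zs k)"
    unfolding limiting_normal_cone_def by blast
  obtain R where R: "linear R" "\<And>y. A (R y) = y" using surj_right_inverse[OF A] by blast
  obtain K where K: "K > 0" "\<And>y. norm (R y) \<le> K * norm y" using linear_bounded_pos[OF R(1)] by blast
  have le: "v \<bullet> h \<le> 0" if h: "A h = 0" for h
  proof -
    define c where "c = norm h * (1 + 2 * K + 2 * K * norm v)"
    have bound: "v \<bullet> h \<le> e * c" if e: "0 < e" "e \<le> 1" for e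
    proof -
      obtain \<rho> where \<rho>: "\<rho> > 0" "\<And>z v. z \<in> ball z0 \<rho> \<Longrightarrow> v \<in> frechet_normal_cone \<Omega> z \<Longrightarrow>
         v \<bullet> h \<le> e * norm h * (1 + 2 * K + 2 * K * norm v)"
        using frechet_normal_near_level_set[OF strict A(1) R K U z0 \<Omega> e h] by metis
      have "eventually (\<lambda>k. zs k \<in> ball z0 \<rho>) sequentially"
        using zs(1) \<rho>(1) by (intro topological_tendstoD) auto
      then have "eventually (\<lambda>k. vs k \<bullet> h \<le> e * norm h * (1 + 2 * K + 2 * K * norm (vs k))) sequentially"
        by eventually_elim (use \<rho>(2) zs(3) in blast)
      moreover have "(\<lambda>k. vs k \<bullet> h) \<longlonglongrightarrow> v \<bullet> h"
        "(\<lambda>k. e * norm h * (1 + 2 * K + 2 * K * norm (vs k))) \<longlonglongrightarrow> e * norm h * (1 + 2 * K + 2 * K * norm v)"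
        by (intro tendsto_intros zs(2))+
      ultimately show ?thesis
        using tendsto_le[OF sequentially_bot] by (fastforce simp: c_def mult.assoc)
    qed
    have "(\<lambda>n. inverse (real (Suc n)) * c) \<longlonglongrightarrow> 0 * c"
      by (intro tendsto_intros LIMSEQ_inverse_real_of_nat)
    moreover have "v \<bullet> h \<le> inverse (real (Suc n)) * c" for n
      by (rule bound) (auto simp: field_simps)
    ultimately show ?thesis using LIMSEQ_le_const by fastforce
  qed
  have perp: "v \<bullet> h = 0" if "A h = 0" for h
    using le[of h] le[of "- h"] that A by (simp add: linear_neg)
  \<comment> \<open>\<open>R\<close> is a right inverse, so \<open>z - R (A z)\<close> lies in the
    kernel and \<open>v \<bullet> z = v \<bullet> R (A z)\<close>; this also exhibits the preimage
    \<open>adjoint R v\<close>.\<close>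
  have "v = adjoint A (adjoint R v)"
  proof (rule vector_eq_rdot[THEN iffD1], rule allI)
    fix z
    have "A (z - R (A z)) = 0" using A R by (simp add: linear_diff)
    from perp[OF this] show "v \<bullet> z = adjoint A (adjoint R v) \<bullet> z"
      using A R by (simp add: adjoint_clauses inner_diff_right)
  qed
  then show "v \<in> range (adjoint A)" by blast
qed

text \<open>The inclusions close up: the range lies in the Frechet cone, this in the limiting cone,
  and this in the range.\<close>

lemma normal_cones_level_set:
  fixes g :: "'a::euclidean_space \<Rightarrow> 'b::euclidean_space"
  assumes "has_strict_derivative g A z0" "linear A" "surj A"
    and "open U" "z0 \<in> U" "g z0 = 0" "\<Omega> \<inter> U = {z \<in> U. g z = 0}"
  shows "limiting_normal_cone \<Omega> z0 = range (adjoint A)"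
    and "frechet_normal_cone \<Omega> z0 = range (adjoint A)"
  using limiting_normal_cone_level_set_subset[OF assms] frechet_subset_limiting_normal_cone[of \<Omega> z0]
    range_adjoint_subset_frechet_normal_cone[OF assms(1,2,4-7)] by auto

subsection \<open>The Lipschitz-like property\<close>

text \<open>Shifting the parameter by \<open>t *\<^sub>R w'\<close> moves some solution by at most
  \<open>l * t * norm w'\<close>. At this graph point the normal inequality reads
  \<open>t * (norm w')\<^sup>2 \<le> e * (1 + l) * t * norm w'\<close>, which fails for small
  \<open>e\<close>.\<close>

lemma locally_Lipschitz_like_frechet_normal_eq_0:
  fixes \<Phi> :: "'a::euclidean_space \<Rightarrow> 'b::euclidean_space set"
  assumes lip: "locally_Lipschitz_like \<Phi> (w0, x0)"
    and n: "(w', 0) \<in> frechet_normal_cone (gph \<Phi>) (w0, x0)"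
  shows "w' = 0"
proof (rule ccontr)
  assume nz: "w' \<noteq> 0"
  have x0: "x0 \<in> \<Phi> w0" using n by (simp add: frechet_normal_cone_def gph_def)
  obtain l U V where l: "l > 0" and U: "x0 \<in> interior U" and V: "w0 \<in> interior V"
    and lip: "\<And>w v. w \<in> V \<Longrightarrow> v \<in> V \<Longrightarrow> \<Phi> v \<inter> U \<subseteq> \<Phi> w + (\<lambda>b. (l * norm (v - w)) *\<^sub>R b) ` cball 0 1"
    using lip unfolding locally_Lipschitz_like_def by auto
  have UV: "x0 \<in> U" "w0 \<in> V" using U V interior_subset by auto
  obtain r where r: "r > 0" "ball w0 r \<subseteq> V" using V mem_interior by blast
  define e where "e = norm w' / (2 * (1 + l))"
  have e: "e > 0" using nz l by (simp add: e_def)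
  obtain d where d: "d > 0"
    "\<And>u. u \<in> gph \<Phi> \<Longrightarrow> norm (u - (w0, x0)) < d \<Longrightarrow> (w', 0) \<bullet> (u - (w0, x0)) \<le> e * norm (u - (w0, x0))"
    using n e unfolding frechet_normal_cone_iff by blast
  define t where "t = min r d / (2 * (1 + l) * norm w')"
  \<comment> \<open>With this \<open>t\<close> the whole displacement, at most
    \<open>t * (1 + l) * norm w'\<close>, is half of \<open>min r d\<close>.\<close>
  have t: "t > 0" using r d nz l by (simp add: t_def)
  have "t * ((1 + l) * norm w') = min r d / 2"
  proof -
    have "m / (2 * c) * c = m / 2" if "c > 0" for m c :: real using that by simp
    from this[of "(1 + l) * norm w'"] show ?thesis using nz l by (simp only: t_def mult.assoc zero_less_mult_iff zero_less_norm_iff) simp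
  qed
  then have td: "t * ((1 + l) * norm w') < min r d" using r(1) d(1) by linarith
  have "t * norm w' \<le> t * ((1 + l) * norm w')" using t l by (intro mult_left_mono) (auto simp: distrib_right)
  then have "t * norm w' < r" using td by linarith
  then have "w0 + t *\<^sub>R w' \<in> ball w0 r" using t by (simp add: dist_norm)
  then have "w0 + t *\<^sub>R w' \<in> V" using r by blast
  \<comment> \<open>The property is read from \<open>w0\<close> to the shifted parameter:
    \<open>x0\<close> lies within the Lipschitz distance of some \<open>x\<close> in the shifted
    value.\<close>
  from lip[OF this UV(2)] x0 UV(1)
  obtain x b where xb: "x \<in> \<Phi> (w0 + t *\<^sub>R w')" "norm b \<le> 1" "x0 = x + (l * norm (t *\<^sub>R w')) *\<^sub>R b"
    by (fastforce elim!: set_plus_elim)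
  define u where "u = (w0 + t *\<^sub>R w', x)"
  have "norm (x - x0) \<le> l * (t * norm w')"
    using xb(2,3) l t by (simp add: mult_left_le)
  moreover have "u - (w0, x0) = (t *\<^sub>R w', x - x0)" by (simp add: u_def)
  ultimately have nu: "norm (u - (w0, x0)) \<le> t * ((1 + l) * norm w')"
    using norm_Pair_le[of "t *\<^sub>R w'" "x - x0"] t by (simp add: algebra_simps)
  have "(w', 0) \<bullet> (u - (w0, x0)) \<le> e * norm (u - (w0, x0))"
    using nu td xb(1) by (intro d(2)) (auto simp: u_def gph_def)
  also have "\<dots> \<le> e * (t * ((1 + l) * norm w'))" using nu e by (intro mult_left_mono) auto
  also have "\<dots> = (e * (1 + l)) * (t * norm w')" by (simp only: ac_simps)
  also have "e * (1 + l) = norm w' / 2" using l by (simp add: e_def field_simps)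
  also have "norm w' / 2 * (t * norm w') = t * (norm w')\<^sup>2 / 2" by (simp add: power2_eq_square)
  finally have "t * (norm w')\<^sup>2 \<le> t * (norm w')\<^sup>2 / 2"
    by (simp add: u_def power2_norm_eq_inner)
  moreover have "t * (norm w')\<^sup>2 > 0" using t nz by simp
  ultimately show False by simp
qed

text \<open>The partial derivative in the second variable has the right inverse \<open>R\<close>, so
  the correction can leave \<open>w\<close> fixed. For \<open>x'\<close> in \<open>\<Phi> w'\<close>
  the residual of \<open>g\<close> at \<open>(w, x')\<close> is at most
  \<open>(1 + B) * norm (w' - w)\<close>, and the correction yields \<open>x' + R y\<close> in
  \<open>\<Phi> w\<close>.\<close>

lemma locally_Lipschitz_like_level_set:
  fixes g :: "'a::euclidean_space \<times> 'b::euclidean_space \<Rightarrow> 'c::euclidean_space"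
  assumes strict: "has_strict_derivative g A (w0, x0)" and A: "linear A"
    and R: "linear R" "\<And>y. A (0, R y) = y"
    and U: "open U" "(w0, x0) \<in> U" and z0: "g (w0, x0) = 0"
    and \<Phi>: "gph \<Phi> \<inter> U = {z \<in> U. g z = 0}"
  shows "locally_Lipschitz_like \<Phi> (w0, x0)"
proof -
  define z0 where "z0 = (w0, x0)"
  have "linear (\<lambda>y. (0::'a, R y))" using R(1) by (simp add: linear_iff)
  then obtain r where r: "r > 0"
    "\<And>z. z \<in> ball z0 r \<Longrightarrow> \<exists>y. norm y \<le> 2 * norm (g z) \<and> g (z + (0, R y)) = 0"
    using level_set_correction[OF strict A, of "\<lambda>y. (0, R y)"] R(2) z0 unfolding z0_def by metis
  obtain d where d: "d > 0"
    "\<And>x y. x \<in> ball z0 d \<Longrightarrow> y \<in> ball z0 d \<Longrightarrow> norm (g x - g y - A (x - y)) \<le> 1 * norm (x - y)"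
    using has_strict_derivativeD[OF strict, of 1] unfolding z0_def by auto
  obtain s where s: "s > 0" "ball z0 s \<subseteq> U" using U open_contains_ball unfolding z0_def by blast
  obtain K where K: "K > 0" "\<And>y. norm (R y) \<le> K * norm y" using linear_bounded_pos[OF R(1)] by blast
  obtain B where B: "B > 0" "\<And>y. norm (A y) \<le> B * norm y" using linear_bounded_pos[OF A] by blast
  \<comment> \<open>The factor 2 comes from the correction, \<open>K\<close> from \<open>R\<close>,
    and \<open>1 + B\<close> is a Lipschitz constant of \<open>g\<close> near
    \<open>z0\<close>.\<close>
  define l where "l = 2 * K * (1 + B)"
  have l: "l > 0" using K B by (simp add: l_def)
  have g_lip: "norm (g x - g y) \<le> (1 + B) * norm (x - y)" if "x \<in> ball z0 d" "y \<in> ball z0 d" for x y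
    using d(2)[OF that] B(2)[of "x - y"] norm_triangle_sub[of "g x - g y" "A (x - y)"]
    by (simp add: algebra_simps)
  \<comment> \<open>A corrected point is within \<open>\<rho> + l * \<rho>\<close> of
    \<open>z0\<close>; the last bound keeps it in \<open>U\<close>, where the level set describes
    the graph.\<close>
  define \<rho> where "\<rho> = min (min r d) (s / (1 + l))"
  have \<rho>: "\<rho> > 0" "\<rho> \<le> r" "\<rho> \<le> d" "\<rho> * (1 + l) \<le> s"
  proof -
    show "\<rho> > 0" "\<rho> \<le> r" "\<rho> \<le> d" using r d s l by (auto simp: \<rho>_def)
    have "\<rho> \<le> s / (1 + l)" by (simp add: \<rho>_def)
    then show "\<rho> * (1 + l) \<le> s" using l by (simp add: pos_le_divide_eq)
  qed
  have \<rho>s: "\<rho> \<le> s"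
  proof -
    have "\<rho> \<le> \<rho> * (1 + l)" using \<rho>(1) l by (simp add: distrib_left)
    then show ?thesis using \<rho>(4) by linarith
  qed
  define V where "V = ball w0 (\<rho> / 2)"
  define W where "W = ball x0 (\<rho> / 2)"
  have near: "(w, x) \<in> ball z0 \<rho>" if "w \<in> V" "x \<in> W" for w x
    using that norm_Pair_le[of "w0 - w" "x0 - x"] by (simp add: V_def W_def z0_def dist_norm)
  have "x' \<in> \<Phi> w + (\<lambda>b. (l * norm (w' - w)) *\<^sub>R b) ` cball 0 1"
    if w: "w \<in> V" "w' \<in> V" and x': "x' \<in> \<Phi> w'" "x' \<in> W" for w w' x'
  proof -
    have n: "(w', x') \<in> ball z0 \<rho>" "(w, x') \<in> ball z0 \<rho>" using near w x' by auto
    have "(w', x') \<in> U" using n(1) \<rho>s s(2) by auto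
    then have "g (w', x') = 0" using \<Phi> x' by (auto simp: gph_def)
    moreover have "norm (g (w, x') - g (w', x')) \<le> (1 + B) * norm (w' - w)"
      using g_lip[of "(w, x')" "(w', x')"] n \<rho>(3) by (simp add: norm_minus_commute)
    ultimately have g1: "norm (g (w, x')) \<le> (1 + B) * norm (w' - w)" by simp
    \<comment> \<open>A second bound on the same residual: comparison with \<open>(w', x')\<close>
      gave the Lipschitz estimate, comparison with \<open>z0\<close> keeps the corrected point in
      \<open>U\<close>.\<close>
    have "norm (g (w, x') - g z0) \<le> (1 + B) * norm ((w, x') - z0)"
      using n \<rho>(3) d(1) by (intro g_lip) auto
    also have "\<dots> \<le> (1 + B) * \<rho>" using n(2) B by (intro mult_left_mono) (auto simp: dist_norm norm_minus_commute)
    finally have g2: "norm (g (w, x')) \<le> (1 + B) * \<rho>" using z0 by (simp add: z0_def)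
    obtain y where y: "norm y \<le> 2 * norm (g (w, x'))" "g ((w, x') + (0, R y)) = 0"
      using r(2)[of "(w, x')"] n(2) \<rho>(2) by auto
    have Ry: "norm (R y) \<le> 2 * K * norm (g (w, x'))"
    proof -
      have "norm (R y) \<le> K * norm y" by (rule K)
      also have "\<dots> \<le> K * (2 * norm (g (w, x')))" using y K by (intro mult_left_mono) auto
      finally show ?thesis by simp
    qed
    have Ry1: "norm (R y) \<le> l * norm (w' - w)"
      using order_trans[OF Ry mult_left_mono[OF g1, of "2 * K"]] K by (simp add: l_def mult.assoc)
    have Ry2: "norm (R y) \<le> l * \<rho>"
      using order_trans[OF Ry mult_left_mono[OF g2, of "2 * K"]] K by (simp add: l_def mult.assoc)
    have "norm (((w, x') - z0) + (0, R y)) < \<rho> + l * \<rho>"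
      using norm_triangle_ineq[of "(w, x') - z0" "(0, R y)"] n(2) Ry2
      by (simp add: dist_norm norm_minus_commute)
    also have "\<dots> \<le> s" using \<rho>(4) by (simp add: algebra_simps)
    finally have "norm (z0 - (w, x' + R y)) < s"
      by (subst norm_minus_commute) (simp add: z0_def algebra_simps)
    then have "(w, x' + R y) \<in> U" using s by (auto simp: subset_iff dist_norm)
    then have "(w, x' + R y) \<in> gph \<Phi>" using y(2) \<Phi> by auto
    then have x: "x' + R y \<in> \<Phi> w" by (simp add: gph_def)
    define c where "c = l * norm (w' - w)"
    have c: "c \<ge> 0" "norm (R y) \<le> c" using Ry1 l by (auto simp: c_def)
    \<comment> \<open>Rescaling to the unit ball divides by \<open>c\<close>; for
      \<open>c = 0\<close> the bound forces \<open>R y = 0\<close>.\<close>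
    have "\<exists>b\<in>cball 0 1. - R y = c *\<^sub>R b"
    proof (cases "c = 0")
      case False
      then show ?thesis using c by (intro bexI[of _ "(- R y) /\<^sub>R c"]) (auto simp: field_simps)
    next
      case True
      then show ?thesis using c by (intro bexI[of _ 0]) auto
    qed
    then have "- R y \<in> (\<lambda>b. c *\<^sub>R b) ` cball 0 1" by blast
    from set_plus_intro[OF x this] show ?thesis by (simp add: c_def)
  qed
  moreover have "x0 \<in> interior W" "w0 \<in> interior V" using \<rho>(1) by (auto simp: V_def W_def)
  ultimately show ?thesis unfolding locally_Lipschitz_like_def using l
    by (intro exI[of _ l] conjI exI[of _ W] exI[of _ V]) auto
qed

subsection \<open>The partial gradient\<close>

text \<open>Chain rule along a line; it identifies the partial derivatives defined through
  \<open>deriv\<close> with values of the total derivative.\<close>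

lemma has_derivative_imp_directional_deriv:
  fixes f :: "'a::real_normed_vector \<Rightarrow> real"
  assumes "(f has_derivative D) (at z)"
  shows "directional_deriv b f z = D b"
proof -
  have D: "linear D" using assms has_derivative_linear by blast
  have "((\<lambda>t. z + t *\<^sub>R b) has_derivative (\<lambda>t. t *\<^sub>R b)) (at 0)"
    by (auto intro!: derivative_eq_intros)
  then have "((\<lambda>t. f (z + t *\<^sub>R b)) has_derivative (\<lambda>t. D (t *\<^sub>R b))) (at 0)"
    by (rule has_derivative_compose) (use assms in simp)
  then have "((\<lambda>t. f (z + t *\<^sub>R b)) has_field_derivative D b) (at 0)"
    using D by (simp add: has_field_derivative_def linear_cmul mult_commute_abs)
  then show ?thesis unfolding directional_deriv_def by (rule DERIV_imp_deriv)
qed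

lemma has_strict_derivative_imp_has_derivative:
  assumes "has_strict_derivative g A z" "bounded_linear A"
  shows "(g has_derivative A) (at z)"
  unfolding has_derivative_at_alt
proof (intro conjI allI impI)
  fix e :: real assume "e > 0"
  then obtain d where d: "d > 0"
    "\<And>x y. x \<in> ball z d \<Longrightarrow> y \<in> ball z d \<Longrightarrow> norm (g x - g y - A (x - y)) \<le> e * norm (x - y)"
    using has_strict_derivativeD[OF assms(1)] by metis
  then show "\<exists>d>0. \<forall>y. norm (y - z) < d \<longrightarrow> norm (g y - g z - A (y - z)) \<le> e * norm (y - z)"
    by (intro exI[of _ d]) (auto simp: dist_norm norm_minus_commute)
qed fact

lemma linear_axis_expansion:
  fixes D :: "(real^'n) \<times> (real^'d) \<Rightarrow> real"
  assumes "linear D"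
  shows "D (h, k) = (\<Sum>i\<in>UNIV. D (axis i 1, 0) * h $ i) + (\<Sum>i\<in>UNIV. D (0, axis i 1) * k $ i)"
proof -
  have "linear (\<lambda>h::real^'n. D (h, 0))" "linear (\<lambda>k::real^'d. D (0, k))"
    using assms linear_compose[of "\<lambda>h. (h, 0)" D] linear_compose[of "\<lambda>k. (0, k)" D]
    by (auto simp: o_def linear_iff)
  then have "D (\<Sum>i\<in>UNIV. h $ i *\<^sub>R axis i 1, 0) = (\<Sum>i\<in>UNIV. D (axis i 1, 0) * h $ i)"
    "D (0, \<Sum>i\<in>UNIV. k $ i *\<^sub>R axis i 1) = (\<Sum>i\<in>UNIV. D (0, axis i 1) * k $ i)"
    by (simp_all add: linear_sum[of "\<lambda>h. D (h, 0)"] linear_sum[of "\<lambda>k. D (0, k)"]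
        linear_cmul[of "\<lambda>h. D (h, 0)"] linear_cmul[of "\<lambda>k. D (0, k)"] mult.commute)
  moreover have "(\<Sum>i\<in>UNIV. h $ i *\<^sub>R axis i 1) = h" "(\<Sum>i\<in>UNIV. k $ i *\<^sub>R axis i 1) = k"
    using basis_expansion[of h] basis_expansion[of k] by (simp_all add: scalar_mult_eq_scaleR)
  moreover have "D (h, k) = D (h, 0) + D (0, k)" using linear_add[OF assms, of "(h, 0)" "(0, k)"] by simp
  ultimately show ?thesis by (simp only:)
qed

text \<open>\<open>grad_x f\<close> is the image of \<open>f'\<close> under the bounded linear map
  \<open>L\<close> that evaluates a functional on the \<open>x\<close> axes, and \<open>f'\<close>
  is continuously differentiable. Row-vector products appear because the row index of both matrices
  is the direction of the outer differentiation.\<close>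

lemma grad_x_has_strict_derivative:
  fixes f :: "(real^'n) \<times> (real^'d) \<Rightarrow> real"
  assumes "twice_continuously_differentiable f"
  shows "has_strict_derivative (grad_x f) (\<lambda>(h, k). h v* hessian_xx f z + k v* hessian_wx f z) z"
proof -
  obtain f' :: "(real^'n) \<times> (real^'d) \<Rightarrow> ((real^'n) \<times> (real^'d)) \<Rightarrow>\<^sub>L real" and
    f'' :: "(real^'n) \<times> (real^'d) \<Rightarrow> ((real^'n) \<times> (real^'d)) \<Rightarrow>\<^sub>L ((real^'n) \<times> (real^'d)) \<Rightarrow>\<^sub>L real" where
    f': "\<And>z. (f has_derivative blinfun_apply (f' z)) (at z)"
    and f'': "\<And>z. (f' has_derivative blinfun_apply (f'' z)) (at z)"
    and cont: "continuous_on UNIV f''"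
    using assms unfolding twice_continuously_differentiable_def by blast
  define L :: "(((real^'n) \<times> (real^'d)) \<Rightarrow>\<^sub>L real) \<Rightarrow> real^'n"
    where "L \<phi> = (\<chi> j. blinfun_apply \<phi> (axis j 1, 0))" for \<phi>
  have "bounded_linear L"
  proof (rule bounded_linear_intro)
    fix \<phi> :: "((real^'n) \<times> (real^'d)) \<Rightarrow>\<^sub>L real"
    have "norm (L \<phi>) \<le> (\<Sum>j\<in>UNIV. \<bar>L \<phi> $ j\<bar>)" by (rule norm_le_l1_cart)
    also have "\<dots> \<le> (\<Sum>j\<in>(UNIV::'n set). norm \<phi>)"
    proof (rule sum_mono)
      fix j
      show "\<bar>L \<phi> $ j\<bar> \<le> norm \<phi>"
        using norm_blinfun[of \<phi> "(axis j 1, 0)"] by (simp add: L_def norm_Pair)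
    qed
    finally show "norm (L \<phi>) \<le> norm \<phi> * real CARD('n)" by (simp add: mult.commute)
  qed (auto simp: L_def vec_eq_iff blinfun.add_left blinfun.scaleR_left)
  moreover have "has_strict_derivative f' (f'' z) z" using C1_has_strict_derivative f'' cont by blast
  ultimately have strict: "has_strict_derivative (\<lambda>z. L (f' z)) (\<lambda>h. L (f'' z h)) z"
    by (rule has_strict_derivative_bounded_linear_comp)
  have pd: "directional_deriv b f = (\<lambda>z. f' z b)" for b
    using has_derivative_imp_directional_deriv[OF f'] by blast
  have pd2: "directional_deriv b (\<lambda>z. f' z c) z = f'' z b c" for b c
    by (rule has_derivative_imp_directional_deriv) (auto intro!: derivative_eq_intros f'')
  have "grad_x f = (\<lambda>z. L (f' z))"
    by (simp add: fun_eq_iff grad_x_def L_def pd)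
  moreover have "(\<lambda>(h, k). h v* hessian_xx f z + k v* hessian_wx f z) = (\<lambda>h. L (f'' z h))"
  proof -
    have "linear (\<lambda>p. f'' z p c)" for c
      by (simp add: linear_iff blinfun.add_left blinfun.add_right blinfun.scaleR_left blinfun.scaleR_right)
    note expand = linear_axis_expansion[OF this]
    have "h v* hessian_xx f z + k v* hessian_wx f z = L (f'' z (h, k))" for h k
      by (simp add: vec_eq_iff vector_matrix_mult_def hessian_xx_def hessian_wx_def L_def pd pd2
          expand[of h k] mult.commute)
    then show ?thesis by auto
  qed
  ultimately show ?thesis using strict by simp
qed

lemma linear_block_row:
  fixes H :: "real^'n^'m" and W :: "real^'n^'d"
  shows "linear (\<lambda>(h, k). h v* H + k v* W)"
  by (simp add: linear_iff split_beta vector_matrix_left_distrib scaleR_vector_matrix_assoc algebra_simps)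

text \<open>The adjoint turns row-vector products into matrix-vector products, so applied to the
  derivative of \<open>G\<close> it gives the stated formula for its adjoint.\<close>

lemma adjoint_block_row:
  fixes H :: "real^'n^'m" and W :: "real^'n^'d"
  shows "adjoint (\<lambda>(h, k). h v* H + k v* W) = (\<lambda>v. (H *v v, W *v v))"
  by (rule adjoint_unique) (simp add: split_beta inner_add_left dot_lmul_matrix inner_prod_def)

subsection \<open>The generalized equation near an inactive constraint\<close>

text \<open>By continuity \<open>F < 0\<close> persists for nearby \<open>x\<close>, so
  \<open>x\<close> is interior to the feasible set of the fixed \<open>w\<close>.\<close>

lemma normal_map_eq_0:
  assumes "continuous_on UNIV F" "F z < 0"
  shows "normal_map F z = {0}"
proof -
  obtain x w where z: "z = (x, w)" by (cases z)
  have "continuous_on UNIV (\<lambda>x. F (x, w))"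
    by (rule continuous_on_compose2[OF assms(1)]) (auto intro!: continuous_intros)
  then have "open {x. F (x, w) < 0}" by (auto intro!: open_Collect_less continuous_intros)
  moreover have "{x. F (x, w) < 0} \<subseteq> feasible_set F w" by (auto simp: feasible_set_def)
  ultimately have "x \<in> interior (feasible_set F w)"
    using interior_maximal assms(2) z by blast
  then show ?thesis by (simp add: normal_map_def z limiting_normal_cone_interior)
qed

text \<open>Over the open set \<open>F < 0\<close> the graph is the zero set of \<open>snd\<close>,
  which is linear and onto, with adjoint \<open>Pair 0\<close>.\<close>

lemma normal_cones_gph_normal_map:
  assumes F: "continuous_on UNIV F" and z: "F z < 0"
  shows "limiting_normal_cone (gph (normal_map F)) (z, 0) = range (Pair 0)"
    and "frechet_normal_cone (gph (normal_map F)) (z, 0) = range (Pair 0)"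
proof -
  let ?U = "{z. F z < 0} \<times> UNIV"
  have 1: "has_strict_derivative snd snd (z, 0)" by (intro linear_has_strict_derivative linear_snd)
  have 2: "open ?U" using F by (intro open_Times open_Collect_less) auto
  have 3: "gph (normal_map F) \<inter> ?U = {p \<in> ?U. snd p = 0}"
    by (auto simp: gph_def normal_map_eq_0[OF F])
  have 4: "adjoint snd = Pair 0" by (rule adjoint_unique) (simp add: inner_prod_def)
  have 5: "(z, 0) \<in> ?U" using z by simp
  note * = normal_cones_level_set[OF 1 linear_snd _ 2 5 _ 3]
  show "limiting_normal_cone (gph (normal_map F)) (z, 0) = range (Pair 0)"
    "frechet_normal_cone (gph (normal_map F)) (z, 0) = range (Pair 0)"
    using * by (simp_all add: 4)
qed

lemma gph_solution_map_inactive: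
  fixes F :: "(real^'n) \<times> (real^'d) \<Rightarrow> real"
  assumes "continuous_on UNIV F"
  shows "gph (solution_map f0 F) \<inter> {p. F (prod.swap p) < 0} =
    {p \<in> {p. F (prod.swap p) < 0}. (grad_x f0 \<circ> prod.swap) p = 0}"
  using normal_map_eq_0[OF assms] by (auto simp: gph_def solution_map_def elt_set_plus_def)

theorem mainTheorem4:
  fixes f0 F :: "(real^'n) \<times> (real^'d) \<Rightarrow> real"
    and xbar :: "real^'n" and wbar :: "real^'d"
  defines "G \<equiv> grad_x f0"
    and "M \<equiv> normal_map F"
    and "S \<equiv> solution_map f0 F"
    and "\<tau> \<equiv> ((xbar, wbar), - grad_x f0 (xbar, wbar))"
    and "Hxx \<equiv> hessian_xx f0 (xbar, wbar)"
    and "Hwx \<equiv> hessian_wx f0 (xbar, wbar)"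
  defines "Gadj \<equiv> adjoint (frechet_derivative G (at (xbar, wbar)))"
  defines "Gam_hat \<equiv> \<lambda>x'. \<Union>v. {w'. (- x', w') \<in> Gadj v +o frechet_coderivative M \<tau> v}"
    and "Gam \<equiv> \<lambda>x'. \<Union>v. {w'. (- x', w') \<in> Gadj v +o limiting_coderivative M \<tau> v}"
    and "CQ \<equiv> (\<forall>v. 0 \<in> Gadj v +o limiting_coderivative M \<tau> v \<longrightarrow> v = 0)"
    and "condI \<equiv> matrix_ker Hxx \<subseteq> matrix_ker Hwx"
    and "condK \<equiv> matrix_ker Hxx \<inter> matrix_ker Hwx = {0}"
  assumes f0_C2: "twice_continuously_differentiable f0"
    and F_C2: "twice_continuously_differentiable F"
    and xbar: "xbar \<in> S wbar"
    and F_neg: "F (xbar, wbar) < 0"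
  shows
    "\<tau> \<in> gph M \<and> (xbar, wbar) \<in> interior {z. F z \<le> 0} \<and>
     \<comment> \<open>(1)\<close>
     ((\<forall>v. limiting_coderivative M \<tau> v = {0} \<and> frechet_coderivative M \<tau> v = {0}) \<and>
      graphically_regular M \<tau>) \<and>
     \<comment> \<open>(2)\<close>
     (CQ \<longrightarrow>
       (\<forall>x'. Gam_hat x' = limiting_coderivative S (wbar, xbar) x' \<and>
             limiting_coderivative S (wbar, xbar) x' = Gam x') \<and>
       (\<forall>x'. limiting_coderivative S (wbar, xbar) x' = (\<Union>v. {w'. (- x', w') = Gadj v})) \<and>
       limiting_coderivative S (wbar, xbar) 0 = {w'. \<exists>v. (0, w') = Gadj v} \<and>
       (locally_Lipschitz_like S (wbar, xbar) \<longleftrightarrow>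
          limiting_coderivative S (wbar, xbar) 0 = {0}) \<and>
       (limiting_coderivative S (wbar, xbar) 0 = {0} \<longleftrightarrow>
          {w'. \<exists>v. Hxx *v v = 0 \<and> w' = Hwx *v v} = {0}) \<and>
       ({w'. \<exists>v. Hxx *v v = 0 \<and> w' = Hwx *v v} = {0} \<longleftrightarrow> condI)) \<and>
     \<comment> \<open>(3)\<close>
     ((CQ \<longleftrightarrow> condK) \<and>
      (condK \<longrightarrow> (locally_Lipschitz_like S (wbar, xbar) \<longleftrightarrow> condI)))"
proof -

  \<comment> \<open>The derivative of \<open>G\<close>, the coderivatives of \<open>M\<close> and
    the form of (CQ)\<close>
  define A where "A = (\<lambda>(h, k). h v* Hxx + k v* Hwx)"
  have A: "linear A" "adjoint A = (\<lambda>v. (Hxx *v v, Hwx *v v))"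
    unfolding A_def by (rule linear_block_row, rule adjoint_block_row)
  have strict: "has_strict_derivative G A (xbar, wbar)"
    using grad_x_has_strict_derivative[OF f0_C2] by (simp add: G_def A_def Hxx_def Hwx_def)
  then have "(G has_derivative A) (at (xbar, wbar))"
    using A(1) by (intro has_strict_derivative_imp_has_derivative) (auto simp: linear_conv_bounded_linear)
  then have Gadj: "Gadj = (\<lambda>v. (Hxx *v v, Hwx *v v))"
    unfolding Gadj_def using frechet_derivative_at A(2) by metis
  have F_cont: "continuous_on UNIV F"
    using F_C2 unfolding twice_continuously_differentiable_def
    by (metis has_derivative_continuous continuous_at_imp_continuous_on)
  have G0: "G (xbar, wbar) = 0"
    using xbar normal_map_eq_0[OF F_cont F_neg] by (simp add: S_def solution_map_def elt_set_plus_def G_def)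
  then have \<tau>: "\<tau> = ((xbar, wbar), 0)" by (simp add: \<tau>_def G_def)
  have \<tau>_gph: "\<tau> \<in> gph M" using normal_map_eq_0[OF F_cont F_neg] by (simp add: \<tau> gph_def M_def)
  have opn: "open {z. F z < 0}" using F_cont by (intro open_Collect_less) auto
  then have int: "(xbar, wbar) \<in> interior {z. F z \<le> 0}"
    using F_neg by (intro interiorI[of "{z. F z < 0}"]) auto
  note nM = normal_cones_gph_normal_map[OF F_cont F_neg, folded M_def \<tau>]
  have codM: "limiting_coderivative M \<tau> v = {0}" "frechet_coderivative M \<tau> v = {0}" for v
    by (auto simp: limiting_coderivative_def frechet_coderivative_def nM)
  have reg: "graphically_regular M \<tau>" by (simp add: graphically_regular_def nM)
  \<comment> \<open>As the coderivative of \<open>M\<close> is \<open>{0}\<close>, (CQ) says that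
    the adjoint has trivial kernel.\<close>
  have CQ_iff: "CQ \<longleftrightarrow> (\<forall>v. Gadj v = 0 \<longrightarrow> v = 0)"
    by (auto simp: CQ_def codM elt_set_plus_def)
  have Gam: "Gam x' = (\<Union>v. {w'. (- x', w') = Gadj v})" "Gam_hat x' = (\<Union>v. {w'. (- x', w') = Gadj v})" for x'
    by (simp_all add: Gam_def Gam_hat_def codM elt_set_plus_def)
  have CQ_condK: "CQ \<longleftrightarrow> condK"
    by (auto simp: CQ_iff condK_def matrix_ker_def Gadj zero_prod_def)
  have image_iff: "{w'. \<exists>v. Hxx *v v = 0 \<and> w' = Hwx *v v} = {0} \<longleftrightarrow> condI"
  proof -
    have "Hxx *v 0 = 0" "Hwx *v 0 = 0" by simp_all
    then have "0 \<in> {w'. \<exists>v. Hxx *v v = 0 \<and> w' = Hwx *v v}" by (metis (mono_tags) mem_Collect_eq)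
    then show ?thesis unfolding condI_def matrix_ker_def by blast
  qed

  \<comment> \<open>The coderivative of \<open>S\<close> and the Lipschitz-like property under
    (CQ)\<close>
  define U where "U = {p. F (prod.swap p) < 0}"
  have U: "open U"
    unfolding U_def
    by (intro open_Collect_less continuous_on_compose2[OF F_cont] continuous_intros continuous_on_swap) auto
  have zU: "(wbar, xbar) \<in> U" using F_neg by (simp add: U_def)
  have gphS: "gph S \<inter> U = {p \<in> U. (G \<circ> prod.swap) p = 0}"
    unfolding S_def U_def G_def by (rule gph_solution_map_inactive[OF F_cont])
  have g0: "(G \<circ> prod.swap) (wbar, xbar) = 0" using G0 by simp
  have strict': "has_strict_derivative (G \<circ> prod.swap) (A \<circ> prod.swap) (wbar, xbar)"
    using has_strict_derivative_swap[OF strict] .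
  have lin': "linear (A \<circ> prod.swap)"
    using A(1) by (intro linear_compose) (auto simp: linear_iff)
  have adj': "adjoint (A \<circ> prod.swap) = (\<lambda>v. (Hwx *v v, Hxx *v v))"
    by (rule adjoint_unique)
      (simp add: A_def split_beta inner_add_left dot_lmul_matrix inner_prod_def add.commute)
  have part2: "(\<forall>x'. limiting_coderivative S (wbar, xbar) x' = (\<Union>v. {w'. (- x', w') = Gadj v})) \<and>
       limiting_coderivative S (wbar, xbar) 0 = {w'. \<exists>v. (0, w') = Gadj v} \<and>
       (locally_Lipschitz_like S (wbar, xbar) \<longleftrightarrow> limiting_coderivative S (wbar, xbar) 0 = {0}) \<and>
       (limiting_coderivative S (wbar, xbar) 0 = {0} \<longleftrightarrow>
          {w'. \<exists>v. Hxx *v v = 0 \<and> w' = Hwx *v v} = {0})" if CQ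
  proof -
    \<comment> \<open>Injectivity of the adjoint is dual to surjectivity of the derivative, which
      the level set result requires.\<close>
    have "inj (adjoint (A \<circ> prod.swap))"
      using \<open>CQ\<close> linear_injective_0[OF adjoint_linear[OF lin']] by (simp add: CQ_iff Gadj adj' zero_prod_def)
    then have "surj (A \<circ> prod.swap)" using lin' by simp
    note nS = normal_cones_level_set[OF strict' lin' this U zU g0 gphS, unfolded adj']
    have cod: "limiting_coderivative S (wbar, xbar) x' = (\<Union>v. {w'. (- x', w') = Gadj v})" for x'
      by (auto simp: limiting_coderivative_def nS Gadj)
    have cod0: "limiting_coderivative S (wbar, xbar) 0 = {w'. \<exists>v. (0, w') = Gadj v}"
      by (auto simp: cod)
    have cod0': "limiting_coderivative S (wbar, xbar) 0 = {w'. \<exists>v. Hxx *v v = 0 \<and> w' = Hwx *v v}"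
      by (auto simp: cod0 Gadj)
    have "locally_Lipschitz_like S (wbar, xbar)" if "limiting_coderivative S (wbar, xbar) 0 = {0}"
    proof -
      have condI using that image_iff by (simp add: cod0')
      \<comment> \<open>(I) places the kernel of \<open>Hxx\<close> inside the intersection that (K)
        makes trivial. By duality the transpose of \<open>Hxx\<close> is onto; it is the partial
        derivative of \<open>G\<close> in \<open>x\<close>, and \<open>R\<close> is a right inverse
        of it.\<close>
      then have "matrix_ker Hxx = {0}"
        using CQ_condK \<open>CQ\<close> by (auto simp: condI_def condK_def)
      then have "inj ((*v) Hxx)"
        using linear_injective_0[OF matrix_vector_mul_linear, of Hxx] by (auto simp: matrix_ker_def)
      then have "surj (adjoint ((*v) Hxx))" by simp
      then obtain R where R: "linear R" "\<And>y. adjoint ((*v) Hxx) (R y) = y"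
        using surj_right_inverse[OF adjoint_linear[OF matrix_vector_mul_linear]] by metis
      have "(A \<circ> prod.swap) (0, R y) = y" for y
        using R(2)[of y] by (simp add: A_def adjoint_matrix)
      then show ?thesis
        using locally_Lipschitz_like_level_set[OF strict' lin' R(1) _ U zU g0 gphS] by blast
    qed
    moreover have "limiting_coderivative S (wbar, xbar) 0 = {0}" if "locally_Lipschitz_like S (wbar, xbar)"
    proof -
      \<comment> \<open>The exclusion result concerns Frechet normals; it applies because both cones
        to the graph of \<open>S\<close> coincide here.\<close>
      have "w' = 0" if "w' \<in> limiting_coderivative S (wbar, xbar) 0" for w'
        using that locally_Lipschitz_like_frechet_normal_eq_0[OF \<open>locally_Lipschitz_like S (wbar, xbar)\<close>, of w']
        by (simp add: limiting_coderivative_def nS)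
      moreover have "0 \<in> limiting_coderivative S (wbar, xbar) 0" by (auto simp: cod0' intro: exI[of _ 0])
      ultimately show ?thesis by blast
    qed
    ultimately have lip: "locally_Lipschitz_like S (wbar, xbar) \<longleftrightarrow> limiting_coderivative S (wbar, xbar) 0 = {0}"
      by blast
    show ?thesis by (intro conjI allI cod cod0 lip) (simp only: cod0')
  qed
  have part2': "\<And>x'. Gam_hat x' = limiting_coderivative S (wbar, xbar) x' \<and>
      limiting_coderivative S (wbar, xbar) x' = Gam x'" if CQ
    using part2[OF that] Gam by metis
  have part3: "locally_Lipschitz_like S (wbar, xbar) \<longleftrightarrow> condI" if condK
  proof -
    have CQ using that CQ_condK by simp
    note lip = part2[OF this, THEN conjunct2, THEN conjunct2]
    from lip[THEN conjunct1] lip[THEN conjunct2] image_iff show ?thesis by argo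
  qed
  show ?thesis
    by (intro conjI impI allI \<tau>_gph int codM reg part3 CQ_condK image_iff
        part2'[THEN conjunct1] part2'[THEN conjunct2]
        part2[THEN conjunct1, THEN spec] part2[THEN conjunct2, THEN conjunct1]
        part2[THEN conjunct2, THEN conjunct2, THEN conjunct1]
        part2[THEN conjunct2, THEN conjunct2, THEN conjunct2])
qed

end
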